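(* Let $\theta\in\mathbb R$ and let $(X\sqcup Y,E)$ be a finite bipartite graph with positive surplus from $X$, i.e. $|\partial S|-|S|>0$ for every non-empty $S\subseteq X$, where $\partial S$ is the set of vertices outside $S$ adjacent to a vertex of $S$. Let $G$ be any finite graph (with a Schrödinger operator) built from $(X\sqcup Y,E)$ as follows: (1) add arbitrary edges between vertices of $X$; (2) replace each $y\in Y$ by a $\theta$-critical graph $K_y$, and replace each edge of $E$ joining $x\in X$ to $y$ by an edge joining $x$ to some vertex of $K_y$; (3) add a graph $H$ such that $\theta$ is not a root of the generalised matching polynomial of $H$, and add arbitrary edges between $V(H)$ and $X$. Then the $\theta$-critical components of $G$ (the connected components of the subgraph of $G$ induced on the set $D_\theta(G)$ of $\theta$-essential vertices) are exactly the graphs $K_y$, $y\in Y$. Moreover, $X$ is the set of $\theta$-special vertices of $G$, that is, $X=\partial D_\theta(G)$.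
   Context: Graphs are finite multigraphs: parallel edges and loops are allowed. $\vec E(G)$ is the set of edges with both orientations; $\bar e$ is the reverse of $e$, and $o(e),t(e)$ its origin and terminus. A Schrödinger operator on $G=(V,E)$ is $\mathcal H=\sum_{e\in\vec E}w_eA_e+\mathcal V$, where $A_e$ is the matrix with $1$ in entry $(o(e),t(e))$ and $0$ elsewhere, $w_{\bar e}=\overline{w_e}\neq0$, and $\mathcal V=\mathrm{diag}(\mathcal V_v)_{v\in V}$ is real. Subgraphs carry the restricted operator; in the construction, $K_y$ and $H$ carry the restriction of the Schrödinger operator of $G$, and the weights of the edges involving $X$ and the potentials on $X$ are arbitrary. A matching $M$ is a set of pairwise vertex-disjoint non-loop edges (possibly empty), $V(M)$ its set of covered vertices, $\vec E(M)$ its edges with both orientations, $\mathcal M_G$ the set of matchings of $G$. The generalised matching polynomial is $m_G(x)=\sum_{M\in\mathcal M_G}(-1)^{|E(M)|}\prod_{e\in\vec E(M)}w_e\prod_{u\in V\setminus V(M)}(x-\mathcal V_u)$ (equal to $1$ for the empty graph), and $\operatorname{mult}_\theta(G)$ is the multiplicity of $\theta$ as a zero of $m_G$. A vertex $v$ of $G$ is $\theta$-essential if $\operatorname{mult}_\theta(G\setminus\{v\})=\operatorname{mult}_\theta(G)-1$. $D_\theta(G)$ is the set of $\theta$-essential vertices (also the subgraph induced on it). Vertices in $\partial D_\theta(G)$ (vertices outside $D_\theta(G)$ adjacent to a vertex of $D_\theta(G)$) are called $\theta$-special. A connected graph is $\theta$-critical if all of its vertices are $\theta$-essential in it. *)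

theory Defs
  imports
    Complex_Main
    "HOL-Computational_Algebra.Polynomial"
    "Graph_Theory.Bidirected_Digraph"
    "Graph_Theory.Digraph_Component"
begin

text \<open>
  A multigraph is a digraph \<open>G\<close> whose arcs are the oriented edges, together with a fixed-point-free
  involution \<open>r\<close> on the arcs that reverses orientation. Thus an edge is a two-element orbit
  \<open>{a, r a}\<close>; loops (which also give two arcs) and parallel edges are allowed.

  A Schroedinger operator \<open>\<Sum>a. w a A_a + diag U\<close> on \<open>G\<close> is given by its weights \<open>w\<close> and its potential
  \<open>U\<close>, an arbitrary real function. On a subgraph it is restricted, so the same \<open>r\<close>, \<open>w\<close> and \<open>U\<close> are
  used for all subgraphs of \<open>G\<close> and their values outside the subgraph are ignored.
\<close>

locale schroedinger_graph = fin_digraph G + bidirected_digraph G r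
  for G :: "('v, 'e) pre_digraph" and r :: "'e \<Rightarrow> 'e" +
  fixes w :: "'e \<Rightarrow> complex"
  assumes weight_rev: "a \<in> arcs G \<Longrightarrow> w (r a) = cnj (w a)"
    and weight_nonzero: "a \<in> arcs G \<Longrightarrow> w a \<noteq> 0"

definition edges :: "('v, 'e) pre_digraph \<Rightarrow> ('e \<Rightarrow> 'e) \<Rightarrow> 'e set set" where
  "edges G r = (\<lambda>a. {a, r a}) ` arcs G"

text \<open>As an edge contains both of its orientations, its end vertices are the tails of its arcs.\<close>

definition ends :: "('v, 'e) pre_digraph \<Rightarrow> 'e set \<Rightarrow> 'v set" where
  "ends G e = tail G ` e"

definition matchings :: "('v, 'e) pre_digraph \<Rightarrow> ('e \<Rightarrow> 'e) \<Rightarrow> 'e set set set" where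
  "matchings G r = {M. M \<subseteq> edges G r \<and> (\<forall>e\<in>M. \<forall>a\<in>e. tail G a \<noteq> head G a) \<and>
     pairwise (\<lambda>e f. disjnt (ends G e) (ends G f)) M}"

definition covered :: "('v, 'e) pre_digraph \<Rightarrow> 'e set set \<Rightarrow> 'v set" where
  "covered G M = (\<Union>e\<in>M. ends G e)"

definition matching_poly ::
  "('v, 'e) pre_digraph \<Rightarrow> ('e \<Rightarrow> 'e) \<Rightarrow> ('e \<Rightarrow> complex) \<Rightarrow> ('v \<Rightarrow> real) \<Rightarrow> complex poly" where
  "matching_poly G r w U = (\<Sum>M\<in>matchings G r.
     smult ((-1) ^ card M * (\<Prod>a\<in>\<Union>M. w a))
       (\<Prod>u\<in>verts G - covered G M. [:- complex_of_real (U u), 1:]))"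

definition mult ::
  "real \<Rightarrow> ('v, 'e) pre_digraph \<Rightarrow> ('e \<Rightarrow> 'e) \<Rightarrow> ('e \<Rightarrow> complex) \<Rightarrow> ('v \<Rightarrow> real) \<Rightarrow> nat" where
  "mult \<theta> G r w U = order (complex_of_real \<theta>) (matching_poly G r w U)"

definition essential_verts ::
  "real \<Rightarrow> ('v, 'e) pre_digraph \<Rightarrow> ('e \<Rightarrow> 'e) \<Rightarrow> ('e \<Rightarrow> complex) \<Rightarrow> ('v \<Rightarrow> real) \<Rightarrow> 'v set" where
  "essential_verts \<theta> G r w U = {v \<in> verts G.
     int (mult \<theta> (pre_digraph.del_vert G v) r w U) = int (mult \<theta> G r w U) - 1}"

definition boundary :: "('v, 'e) pre_digraph \<Rightarrow> 'v set \<Rightarrow> 'v set" where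
  "boundary G S = {v \<in> verts G - S. \<exists>u\<in>S. u \<rightarrow>\<^bsub>G\<^esub> v}"

text \<open>Connected graphs are non-empty in the library's convention, hence so are critical graphs.\<close>

definition critical ::
  "real \<Rightarrow> ('v, 'e) pre_digraph \<Rightarrow> ('e \<Rightarrow> 'e) \<Rightarrow> ('e \<Rightarrow> complex) \<Rightarrow> ('v \<Rightarrow> real) \<Rightarrow> bool" where
  "critical \<theta> G r w U \<longleftrightarrow> Digraph_Component.connected G \<and> essential_verts \<theta> G r w U = verts G"

text \<open>
  Arcs come with their reverses, so strong connectivity is ordinary connectivity, and the strongly
  connected components are the connected components.
\<close>

definition critical_components ::
  "real \<Rightarrow> ('v, 'e) pre_digraph \<Rightarrow> ('e \<Rightarrow> 'e) \<Rightarrow> ('e \<Rightarrow> complex) \<Rightarrow> ('v \<Rightarrow> real) \<Rightarrow>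
     ('v, 'e) pre_digraph set" where
  "critical_components \<theta> G r w U = pre_digraph.sccs (G \<restriction> essential_verts \<theta> G r w U)"

locale bipartite_graph = fin_digraph B + bidirected_digraph B s
  for B :: "('x + 'y, 'f) pre_digraph" and s :: "'f \<Rightarrow> 'f" +
  fixes X :: "'x set" and Y :: "'y set"
  assumes verts_bipartite: "verts B = X <+> Y"
    and arcs_bipartite: "a \<in> arcs B \<Longrightarrow> tail B a \<in> Inl ` X \<longleftrightarrow> head B a \<in> Inr ` Y"

definition positive_surplus :: "('v, 'e) pre_digraph \<Rightarrow> 'v set \<Rightarrow> bool" where
  "positive_surplus B A \<longleftrightarrow> (\<forall>S. S \<subseteq> A \<and> S \<noteq> {} \<longrightarrow> card S < card (boundary B S))"

text \<open>
  The graph \<open>G\<close> arises from the bipartite graph \<open>B\<close> by replacing each \<open>y\<close> in \<open>Y\<close> by \<open>K y\<close>, adding \<open>H\<close>,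
  and adding arbitrary edges inside \<open>X\<close> and between \<open>X\<close> and \<open>H\<close>. Each edge between \<open>X\<close> and \<open>Y\<close> has
  exactly one orientation that starts in \<open>X\<close>, so the replacement of edges is a bijection of the arcs
  leaving \<open>X\<close>.
\<close>

locale bipartite_expansion = bipartite_graph B s X Y
  for G :: "('v, 'e) pre_digraph" and B :: "('v + 'y, 'f) pre_digraph" and s :: "'f \<Rightarrow> 'f"
    and X :: "'v set" and Y :: "'y set"
    and K :: "'y \<Rightarrow> ('v, 'e) pre_digraph" and H :: "('v, 'e) pre_digraph" +
  assumes verts_expansion: "verts G = X \<union> (\<Union>y\<in>Y. verts (K y)) \<union> verts H"
    and induced_K: "y \<in> Y \<Longrightarrow> induced_subgraph (K y) G"
    and induced_H: "induced_subgraph H G"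
    and disjoint_X_K: "y \<in> Y \<Longrightarrow> X \<inter> verts (K y) = {}"
    and disjoint_X_H: "X \<inter> verts H = {}"
    and disjoint_K_H: "y \<in> Y \<Longrightarrow> verts (K y) \<inter> verts H = {}"
    and disjoint_K_K: "y \<in> Y \<Longrightarrow> z \<in> Y \<Longrightarrow> y \<noteq> z \<Longrightarrow> verts (K y) \<inter> verts (K z) = {}"
    and arcs_from_K: "y \<in> Y \<Longrightarrow> a \<in> arcs G \<Longrightarrow> tail G a \<in> verts (K y) \<Longrightarrow>
      head G a \<in> X \<union> verts (K y)"
    and arcs_X_K: "\<exists>\<phi>. bij_betw \<phi> {a \<in> arcs B. tail B a \<in> Inl ` X}
        {a \<in> arcs G. tail G a \<in> X \<and> head G a \<in> (\<Union>y\<in>Y. verts (K y))} \<and>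
      (\<forall>a\<in>arcs B. \<forall>x\<in>X. \<forall>y\<in>Y. tail B a = Inl x \<and> head B a = Inr y \<longrightarrow>
        tail G (\<phi> a) = x \<and> head G (\<phi> a) \<in> verts (K y))"

end

theory Submission
  imports Defs
begin

text \<open>
  Write \<open>m S\<close> for the matching polynomial of the subgraph induced on \<open>S\<close>. The recursion
  \<open>m S = (x - U v) m (S - v) - \<Sum>u. c v u m (S - v - u)\<close> with \<open>c \<ge> 0\<close> gives
  \<open>(m S)' m (S - v) - m S (m (S - v))' \<ge> (m (S - v))\<^sup>2\<close> on the reals. Hence the poles at \<open>\<theta>\<close> of
  the quotients \<open>m (S - v - u) / m (S - v)\<close> are simple with positive residues and cannot cancel:
  deleting a neighbour \<open>v\<close> of a vertex that is essential in \<open>S - v\<close> raises the multiplicity by one.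

  Let \<open>H\<close> be arbitrary for the moment. If \<open>X\<close> can be matched into \<open>Y\<close>, then the multiplicity of \<open>G\<close> is
  \<open>mult H + \<Sum>y. mult (K y) - card X\<close>, by induction on \<open>X\<close>: delete \<open>x\<close>, then also its neighbour \<open>u\<close> in
  the graph \<open>K y\<close> matched to it, and absorb \<open>K y - u\<close> into \<open>H\<close>. The induction hypothesis shows that \<open>u\<close>
  is essential in \<open>G - x\<close>. Positive surplus and Hall's theorem provide matchings that avoid any
  prescribed \<open>y\<close>, so the formula applies to all vertex-deleted subgraphs of \<open>G\<close> as well and
  identifies the essential vertices.
\<close>

section \<open>Wronskians and orders of zeros\<close>

text \<open>The numerator of the derivative of the quotient \<open>p / q\<close>. With this sign it
  is nonnegative when \<open>q\<close> arises from \<open>p\<close> by deleting a vertex.\<close>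

definition wronskian :: "real poly \<Rightarrow> real poly \<Rightarrow> real poly" where
  "wronskian p q = pderiv p * q - p * pderiv q"

lemma wronskian_mult_common: "wronskian (h * f) (h * g) = h\<^sup>2 * wronskian f g"
  by (simp add: wronskian_def pderiv_mult algebra_simps power2_eq_square)

text \<open>Divided by \<open>q\<close>, the recursion expresses \<open>p / q\<close> as
  \<open>x - a\<close> minus the quotients \<open>r u / q\<close>; differentiating and multiplying
  by the square of \<open>q\<close> gives the formula, where the minus sign swaps the arguments of
  each Wronskian.\<close>

lemma wronskian_recursion:
  assumes "p = [:- a, 1:] * q - (\<Sum>u\<in>A. smult (k u) (r u))"
  shows "wronskian p q = q\<^sup>2 + (\<Sum>u\<in>A. smult (k u) (wronskian q (r u)))"
proof -
  have deriv: "pderiv p = q + [:- a, 1:] * pderiv q - (\<Sum>u\<in>A. smult (k u) (pderiv (r u)))"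
    unfolding assms
    by (simp add: pderiv_diff pderiv_mult pderiv_smult higher_pderiv_sum[of 1, simplified] pderiv_pCons
        del: mult_pCons_left)
  moreover have "(\<Sum>u\<in>A. smult (k u) (wronskian q (r u)))
      = pderiv q * (\<Sum>u\<in>A. smult (k u) (r u)) - q * (\<Sum>u\<in>A. smult (k u) (pderiv (r u)))"
    by (simp add: wronskian_def sum_distrib_left smult_diff_right sum_subtractf)
  moreover have "wronskian p q = pderiv p * q - ([:- a, 1:] * q - (\<Sum>u\<in>A. smult (k u) (r u))) * pderiv q"
    unfolding wronskian_def by (simp only: assms)
  ultimately show ?thesis
    unfolding deriv by (simp add: algebra_simps power2_eq_square del: mult_pCons_left mult_pCons_right)
qed

text \<open>Continuity; it extends inequalities obtained by division to the zero \<open>a\<close> of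
  the divisor.\<close>

lemma poly_nonneg_at_limit:
  fixes p :: "real poly"
  assumes "\<And>t. t \<noteq> a \<Longrightarrow> 0 \<le> poly p t"
  shows "0 \<le> poly p a"
proof (rule tendsto_lowerbound)
  show "(poly p \<longlongrightarrow> poly p a) (at a)"
    by (intro tendsto_intros)
  show "\<forall>\<^sub>F t in at a. 0 \<le> poly p t"
    using assms by (simp add: eventually_at_filter)
qed simp

text \<open>Both sides of the bound carry the factor \<open>h\<close> squared, which cancels away
  from \<open>a\<close>; continuity covers \<open>a\<close> itself. This strips common powers of
  \<open>[:- a, 1:]\<close>.\<close>

lemma wronskian_quotient_bound:
  fixes f g h :: "real poly"
  assumes "\<And>t. (poly (h * g) t)\<^sup>2 \<le> poly (wronskian (h * f) (h * g)) t"
    and "\<And>t. t \<noteq> a \<Longrightarrow> poly h t \<noteq> 0"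
  shows "(poly g a)\<^sup>2 \<le> poly (wronskian f g) a"
proof -
  have "0 \<le> poly (wronskian f g - g\<^sup>2) a"
  proof (rule poly_nonneg_at_limit)
    fix t assume "t \<noteq> a"
    then have "0 < (poly h t)\<^sup>2" using assms(2) by simp
    moreover have "(poly h t)\<^sup>2 * (poly g t)\<^sup>2 \<le> (poly h t)\<^sup>2 * poly (wronskian f g) t"
      using assms(1)[of t] by (simp add: wronskian_mult_common power_mult_distrib)
    ultimately show "0 \<le> poly (wronskian f g - g\<^sup>2) t" by simp
  qed
  then show ?thesis by simp
qed

lemma order_decomp_root:
  fixes p :: "real poly"
  assumes "p \<noteq> 0"
  obtains q where "p = [:- a, 1:] ^ order a p * q" "poly q a \<noteq> 0"
  using order_decomp[OF assms, of a] by (auto simp: poly_eq_0_iff_dvd)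

text \<open>The bound confines the quotient \<open>r / q\<close> at the zero \<open>a\<close> of
  \<open>q\<close>: a pole of order at least two is impossible, and at a simple pole the residue has
  the sign of \<open>poly q1 a * poly s a\<close>, which is nonnegative.\<close>

lemma wronskian_interlacing:
  fixes q r :: "real poly"
  assumes "q \<noteq> 0" "r \<noteq> 0" and bound: "\<And>t. (poly r t)\<^sup>2 \<le> poly (wronskian q r) t"
    and n: "order a q = Suc n" and q1: "q = [:- a, 1:] ^ Suc n * q1"
  obtains s where "r = [:- a, 1:] ^ n * s" "0 \<le> poly q1 a * poly s a"
    "order a r = n \<Longrightarrow> poly s a \<noteq> 0"
proof -
  let ?L = "[:- a, 1:]"
  obtain s where s: "r = ?L ^ order a r * s" "poly s a \<noteq> 0"
    using order_decomp_root[OF \<open>r \<noteq> 0\<close>] .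
  have "n \<le> order a r"
  proof (rule ccontr)
    assume "\<not> n \<le> order a r"
    then obtain k where k: "Suc n = order a r + Suc (Suc k)"
      by (metis Suc_diff_Suc add_Suc_right le_add_diff_inverse less_imp_le_nat not_le)
    \<comment> \<open>After cancelling the zero of \<open>r\<close>, at least a double zero at
      \<open>a\<close> remains in \<open>f\<close>, so \<open>f\<close> and its derivative vanish
      there while \<open>s\<close> does not.\<close>
    define f where "f = ?L ^ Suc (Suc k) * q1"
    have f: "q = ?L ^ order a r * f"
      unfolding f_def q1 k power_add by (simp only: mult.assoc)
    have "(poly s a)\<^sup>2 \<le> poly (wronskian f s) a"
      by (rule wronskian_quotient_bound[of "?L ^ order a r"]) (use bound s(1) f in auto)
    also have "\<dots> = 0"
      by (simp add: wronskian_def f_def pderiv_mult pderiv_power_Suc del: power_Suc)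
    finally show False using s(2) by simp
  qed
  then obtain j where j: "order a r = n + j" using le_iff_add by blast
  define s' where "s' = ?L ^ j * s"
  have r: "r = ?L ^ n * s'" using s(1) unfolding j s'_def power_add by (simp only: mult.assoc)
  moreover have "0 \<le> poly q1 a * poly s' a"
  proof -
    have "(poly s' a)\<^sup>2 \<le> poly (wronskian (?L * q1) s') a"
      using bound unfolding r q1 power_Suc2 mult.assoc
      by (rule wronskian_quotient_bound) simp
    also have "\<dots> = poly q1 a * poly s' a"
      by (simp add: wronskian_def pderiv_mult pderiv_pCons del: mult_pCons_left mult_pCons_right)
    finally show ?thesis by (meson order_trans zero_le_power2)
  qed
  moreover have "poly s' a \<noteq> 0" if "order a r = n"
    using that j s(2) by (simp add: s'_def)
  ultimately show thesis using that by blast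
qed

text \<open>In \<open>p / q\<close> all poles at \<open>a\<close> come from the quotients
  \<open>r u / q\<close>. They are at most simple with nonnegative residues, and the one for
  \<open>v\<close> has a positive residue, so \<open>p / q\<close> has exactly a simple
  pole.\<close>

lemma order_recursion_pole:
  fixes p q :: "real poly" and r :: "'i \<Rightarrow> real poly"
  assumes p: "p = [:- b, 1:] * q - (\<Sum>u\<in>A. smult (k u) (r u))"
    and "finite A" and k: "\<And>u. u \<in> A \<Longrightarrow> 0 \<le> k u"
    and "q \<noteq> 0" and r: "\<And>u. u \<in> A \<Longrightarrow> r u \<noteq> 0"
    and bound: "\<And>u t. u \<in> A \<Longrightarrow> (poly (r u) t)\<^sup>2 \<le> poly (wronskian q (r u)) t"
    and v: "v \<in> A" "0 < k v" "Suc (order a (r v)) = order a q"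
  shows "Suc (order a p) = order a q"
proof -
  let ?L = "[:- a, 1:]"
  define n where "n = order a (r v)"
  have n: "order a q = Suc n" using v n_def by simp
  obtain q1 where q1: "q = ?L ^ Suc n * q1" "poly q1 a \<noteq> 0"
    using order_decomp_root[OF \<open>q \<noteq> 0\<close>, of a] n by metis
  have "\<exists>s. r u = ?L ^ n * s \<and> 0 \<le> poly q1 a * poly s a \<and> (order a (r u) = n \<longrightarrow> poly s a \<noteq> 0)"
    if "u \<in> A" for u
    by (rule wronskian_interlacing[OF \<open>q \<noteq> 0\<close> r[OF that] bound[OF that] n q1(1)]) blast
  then obtain s where s: "\<And>u. u \<in> A \<Longrightarrow> r u = ?L ^ n * s u"
      "\<And>u. u \<in> A \<Longrightarrow> 0 \<le> poly q1 a * poly (s u) a"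
      "\<And>u. u \<in> A \<Longrightarrow> order a (r u) = n \<Longrightarrow> poly (s u) a \<noteq> 0"
    by metis
  \<comment> \<open>One factor \<open>?L\<close> of \<open>q\<close> survives in the cofactor of
    \<open>?L ^ n\<close>, so at \<open>a\<close> the first term vanishes and only the sum over
    \<open>A\<close> remains.\<close>
  define z where "z = [:- b, 1:] * ?L * q1 - (\<Sum>u\<in>A. smult (k u) (s u))"
  have "p = ?L ^ n * z"
  proof -
    have "(\<Sum>u\<in>A. smult (k u) (r u)) = ?L ^ n * (\<Sum>u\<in>A. smult (k u) (s u))"
      using s(1) by (simp add: sum_distrib_left)
    moreover have "[:- b, 1:] * q = ?L ^ n * ([:- b, 1:] * ?L * q1)"
      unfolding q1 power_Suc by (simp only: mult_ac)
    ultimately show ?thesis unfolding p z_def by (simp only: right_diff_distrib)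
  qed
  moreover have "poly z a \<noteq> 0"
  proof -
    \<comment> \<open>Multiplication by \<open>poly q1 a\<close> makes every summand nonnegative and
      the one at \<open>v\<close> positive, which excludes cancellation.\<close>
    have "0 < (\<Sum>u\<in>A. k u * (poly q1 a * poly (s u) a))"
    proof (rule sum_pos2[OF \<open>finite A\<close> v(1)])
      have "poly q1 a * poly (s v) a > 0"
        using s(2,3)[OF v(1)] q1(2) n_def by (simp add: order_less_le)
      then show "0 < k v * (poly q1 a * poly (s v) a)" using v(2) by simp
    qed (use k s(2) in auto)
    also have "\<dots> = - (poly q1 a * poly z a)"
      by (simp add: z_def poly_sum sum_distrib_left mult_ac del: mult_pCons_left mult_pCons_right)
    finally show ?thesis by auto
  qed
  ultimately have "order a p = n"
    by (metis add.right_neutral mult_eq_0_iff order_0I order_mult order_power_n_n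
        poly_0 power_eq_0_iff pCons_eq_0_iff one_neq_zero)
  then show ?thesis using n by simp
qed

section \<open>Hall's theorem\<close>

text \<open>Induction on \<open>X\<close>. If some proper non-empty \<open>T\<close> has exactly
  \<open>card T\<close> neighbours, match \<open>T\<close> first and the rest outside the
  neighbourhood of \<open>T\<close>. Otherwise every such set has a spare neighbour, so any single
  pair can be matched and removed.\<close>

lemma hall:
  fixes N :: "'a \<Rightarrow> 'b set"
  assumes "finite X" and "\<And>x. x \<in> X \<Longrightarrow> finite (N x)"
    and "\<And>S. S \<subseteq> X \<Longrightarrow> card S \<le> card (\<Union>x\<in>S. N x)"
  shows "\<exists>\<phi>. inj_on \<phi> X \<and> (\<forall>x\<in>X. \<phi> x \<in> N x)"
  using assms
proof (induction X arbitrary: N rule: finite_psubset_induct)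
  case (psubset X)
  note fin = psubset.prems(1) and hall = psubset.prems(2)
  have finU: "finite (\<Union>x\<in>S. N x)" if "S \<subseteq> X" for S
    using that fin finite_subset[OF that psubset.hyps] by auto
  show ?case
  proof (cases "\<exists>T. T \<subset> X \<and> T \<noteq> {} \<and> card (\<Union>x\<in>T. N x) = card T")
    case True
    then obtain T where T: "T \<subset> X" "T \<noteq> {}" "card (\<Union>x\<in>T. N x) = card T" by blast
    define A where "A = (\<Union>x\<in>T. N x)"
    have "\<exists>\<phi>. inj_on \<phi> T \<and> (\<forall>x\<in>T. \<phi> x \<in> N x)"
      by (rule psubset.IH[OF T(1)]) (use T(1) fin hall in auto)
    then obtain \<phi> where \<phi>: "inj_on \<phi> T" "\<forall>x\<in>T. \<phi> x \<in> N x" by blast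
    have "\<exists>\<psi>. inj_on \<psi> (X - T) \<and> (\<forall>x\<in>X - T. \<psi> x \<in> N x - A)"
    proof (rule psubset.IH)
      show "X - T \<subset> X" using T by blast
      fix S assume S: "S \<subseteq> X - T"
      \<comment> \<open>Hall's condition for \<open>S \<union> T\<close> is split along
        \<open>A\<close>: by tightness \<open>A\<close> accounts for only \<open>card T\<close> of
        the neighbours, and at least \<open>card S\<close> are left outside.\<close>
      have "card S + card T = card (S \<union> T)"
        using S T(1) psubset.hyps by (intro card_Un_disjoint[symmetric]) (auto intro: finite_subset)
      also have "\<dots> \<le> card (\<Union>x\<in>S \<union> T. N x)" using S T(1) by (intro hall) auto
      also have "(\<Union>x\<in>S \<union> T. N x) = (\<Union>x\<in>S. N x - A) \<union> A" by (auto simp: A_def)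
      also have "card \<dots> \<le> card (\<Union>x\<in>S. N x - A) + card T"
        using card_Un_le[of "\<Union>x\<in>S. N x - A" A] T(3)[folded A_def] by linarith
      finally show "card S \<le> card (\<Union>x\<in>S. N x - A)" by simp
    qed (use fin in auto)
    then obtain \<psi> where \<psi>: "inj_on \<psi> (X - T)" "\<forall>x\<in>X - T. \<psi> x \<in> N x - A" by blast
    let ?\<chi> = "\<lambda>x. if x \<in> T then \<phi> x else \<psi> x"
    have "inj_on ?\<chi> X"
    proof (rule inj_onI)
      fix x y assume xy: "x \<in> X" "y \<in> X" "?\<chi> x = ?\<chi> y"
      have "\<phi> x \<in> A" if "x \<in> T" for x using \<phi>(2) that by (auto simp: A_def)
      moreover have "\<psi> x \<notin> A" if "x \<in> X" "x \<notin> T" for x using \<psi>(2) that by blast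
      ultimately have "x \<in> T \<longleftrightarrow> y \<in> T" using xy by (metis (full_types))
      then show "x = y"
        using xy \<phi>(1) \<psi>(1) by (cases "x \<in> T") (simp_all add: inj_on_def)
    qed
    moreover have "\<forall>x\<in>X. ?\<chi> x \<in> N x" using \<phi>(2) \<psi>(2) by auto
    ultimately show ?thesis by blast
  next
    case False
    then have strict: "card T < card (\<Union>x\<in>T. N x)" if "T \<subset> X" "T \<noteq> {}" for T
      using that hall[of T] by (metis le_neq_implies_less psubset_imp_subset)
    show ?thesis
    proof (cases "X = {}")
      case False
      then obtain x where x: "x \<in> X" by blast
      then obtain y where y: "y \<in> N x" using hall[of "{x}"] by fastforce
      \<comment> \<open>The strict inequality for proper subsets pays for the loss of
        \<open>y\<close>.\<close>
      have "\<exists>\<psi>. inj_on \<psi> (X - {x}) \<and> (\<forall>z\<in>X - {x}. \<psi> z \<in> N z - {y})"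
      proof (rule psubset.IH)
        show "X - {x} \<subset> X" using x by blast
        fix S assume S: "S \<subseteq> X - {x}"
        have eq: "(\<Union>x\<in>S. N x - {y}) = (\<Union>x\<in>S. N x) - {y}" by auto
        show "card S \<le> card (\<Union>x\<in>S. N x - {y})"
        proof (cases "S = {}")
          case False
          then have "card S < card (\<Union>x\<in>S. N x)" using S x by (intro strict) auto
          then show ?thesis unfolding eq by (auto simp: card_Diff_singleton_if)
        qed simp
      qed (use fin in auto)
      then obtain \<psi> where \<psi>: "inj_on \<psi> (X - {x})" "\<forall>z\<in>X - {x}. \<psi> z \<in> N z - {y}" by blast
      have "inj_on (\<psi>(x := y)) X" "\<forall>z\<in>X. (\<psi>(x := y)) z \<in> N z"
        using \<psi> y by (auto simp: inj_on_def)
      then show ?thesis by blast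
    qed simp
  qed
qed

section \<open>Polynomials satisfying the vertex recursion\<close>

text \<open>Abstracts from graphs: a subgraph becomes its vertex set, deletion becomes set
  difference, and \<open>c v u\<close> stands for the total squared weight between \<open>v\<close>
  and \<open>u\<close>.\<close>

locale vertex_recursion =
  fixes c :: "'v \<Rightarrow> 'v \<Rightarrow> real" and U :: "'v \<Rightarrow> real" and mp :: "'v set \<Rightarrow> real poly" and \<theta> :: real
  assumes c_nonneg: "0 \<le> c u v"
    and mp_empty: "mp {} = 1"
    and mp_rec: "finite S \<Longrightarrow> v \<in> S \<Longrightarrow>
      mp S = [:- U v, 1:] * mp (S - {v}) - (\<Sum>u\<in>S - {v}. smult (c v u) (mp (S - {v} - {u})))"
begin

abbreviation mul :: "'v set \<Rightarrow> nat" where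
  "mul S \<equiv> order \<theta> (mp S)"

text \<open>The recursion writes the Wronskian for \<open>S\<close> as a square plus nonnegative
  multiples of Wronskians for \<open>S - {v}\<close>. The bound in turn forces \<open>mp S\<close>
  to be nonzero, since otherwise \<open>mp (S - {v})\<close> would vanish everywhere.\<close>

lemma mp_nonzero_wronskian:
  assumes "finite S"
  shows "mp S \<noteq> 0 \<and> (\<forall>v\<in>S. \<forall>t. (poly (mp (S - {v})) t)\<^sup>2 \<le> poly (wronskian (mp S) (mp (S - {v}))) t)"
  using assms
proof (induction S rule: finite_psubset_induct)
  case (psubset S)
  have bound: "(poly (mp (S - {v})) t)\<^sup>2 \<le> poly (wronskian (mp S) (mp (S - {v}))) t" if "v \<in> S" for v t
  proof -
    have "S - {v} \<subset> S" using that by blast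
    from psubset.IH[OF this] have "0 \<le> poly (wronskian (mp (S - {v})) (mp (S - {v} - {u}))) t"
      if "u \<in> S - {v}" for u
      using that by (meson order_trans zero_le_power2)
    then show ?thesis
      using wronskian_recursion[OF mp_rec[OF psubset.hyps that]] c_nonneg
      by (auto simp: poly_sum intro!: sum_nonneg mult_nonneg_nonneg)
  qed
  moreover have "mp S \<noteq> 0"
  proof (cases "S = {}")
    case False
    then obtain v where v: "v \<in> S" by blast
    then have "mp (S - {v}) \<noteq> 0" using psubset.IH[of "S - {v}"] by blast
    then obtain t where "poly (mp (S - {v})) t \<noteq> 0" using poly_all_0_iff_0 by blast
    then show ?thesis using bound[OF v, of t] by (auto simp: wronskian_def)
  qed (simp add: mp_empty)
  ultimately show ?case by blast
qed

lemmas mp_nonzero = mp_nonzero_wronskian[THEN conjunct1]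
lemmas mp_wronskian = mp_nonzero_wronskian[THEN conjunct2, rule_format]

text \<open>As \<open>u\<close> is essential in \<open>S - {v}\<close> and coupled to
  \<open>v\<close>, its term supplies the pole with positive residue.\<close>

lemma mul_remove_adjacent_essential:
  assumes "finite S" "v \<in> S" "u \<in> S - {v}" "0 < c v u" "Suc (mul (S - {v} - {u})) = mul (S - {v})"
  shows "Suc (mul S) = mul (S - {v})"
  by (rule order_recursion_pole[OF mp_rec[OF assms(1,2)], where v = u])
    (use assms c_nonneg mp_nonzero mp_wronskian in auto)

text \<open>Expand at a vertex of \<open>S\<close>: its couplings to \<open>T\<close> vanish, so
  every term retains the factor \<open>mp T\<close>.\<close>

lemma mp_disjoint_union:
  assumes "finite S" "finite T" "S \<inter> T = {}" "\<And>u v. u \<in> S \<Longrightarrow> v \<in> T \<Longrightarrow> c u v = 0"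
  shows "mp (S \<union> T) = mp S * mp T"
  using assms
proof (induction S rule: finite_psubset_induct)
  case (psubset S)
  show ?case
  proof (cases "S = {}")
    case False
    then obtain v where v: "v \<in> S" by blast
    have "mp (R \<union> T) = mp R * mp T" if "R \<subset> S" for R
      using that psubset.prems by (intro psubset.IH) auto
    note IH = this
    have sub: "S - {v} \<subset> S" "\<And>u. S - {v} - {u} \<subset> S" using v by auto
    have T: "v \<notin> T" using v psubset.prems by blast
    then have diff: "S \<union> T - {v} = S - {v} \<union> T" by blast
    have "(\<Sum>u\<in>S \<union> T - {v}. smult (c v u) (mp (S \<union> T - {v} - {u})))
        = (\<Sum>u\<in>S - {v}. smult (c v u) (mp (S \<union> T - {v} - {u})))"
      using psubset v T by (intro sum.mono_neutral_right) auto
    also have "\<dots> = (\<Sum>u\<in>S - {v}. smult (c v u) (mp (S - {v} - {u}) * mp T))"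
    proof (rule sum.cong)
      fix u assume "u \<in> S - {v}"
      then have "S \<union> T - {v} - {u} = S - {v} - {u} \<union> T" using T psubset.prems by blast
      then show "smult (c v u) (mp (S \<union> T - {v} - {u})) = smult (c v u) (mp (S - {v} - {u}) * mp T)"
        using IH[OF sub(2)] by simp
    qed simp
    finally have "mp (S \<union> T) = [:- U v, 1:] * (mp (S - {v}) * mp T)
        - (\<Sum>u\<in>S - {v}. smult (c v u) (mp (S - {v} - {u}) * mp T))"
      using mp_rec[of "S \<union> T" v] v psubset IH[OF sub(1)] unfolding diff by simp
    also have "\<dots> = mp S * mp T"
      by (simp only: mp_rec[OF psubset.hyps v] left_diff_distrib sum_distrib_right mult_smult_left mult.assoc)
    finally show ?thesis .
  qed (simp add: mp_empty)
qed

lemma mul_disjoint_union: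
  assumes "finite S" "finite T" "S \<inter> T = {}" "\<And>u v. u \<in> S \<Longrightarrow> v \<in> T \<Longrightarrow> c u v = 0"
  shows "mul (S \<union> T) = mul S + mul T"
  using mp_disjoint_union[OF assms] assms(1,2) mp_nonzero by (simp add: order_mult)

text \<open>The vertex sets of the construction. Couplings from a part \<open>K y\<close> to another
  part or to \<open>H\<close> are excluded, those involving \<open>X\<close> are free. There is no
  condition on \<open>mul H\<close>, so that \<open>H\<close> can absorb pieces of the parts during
  an induction.\<close>

definition separated :: "'v set \<Rightarrow> 'y set \<Rightarrow> ('y \<Rightarrow> 'v set) \<Rightarrow> 'v set \<Rightarrow> bool" where
  "separated X Y K H \<longleftrightarrow> finite X \<and> finite Y \<and> finite H \<and> X \<inter> H = {} \<and>
     (\<forall>y\<in>Y. finite (K y) \<and> X \<inter> K y = {} \<and> K y \<inter> H = {} \<and> (\<forall>u\<in>K y. \<forall>v\<in>H. c u v = 0) \<and>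
       (\<forall>z\<in>Y. y \<noteq> z \<longrightarrow> K y \<inter> K z = {} \<and> (\<forall>u\<in>K y. \<forall>v\<in>K z. c u v = 0)))"

lemma separated_mono:
  assumes sep: "separated X Y K H" and sub: "X' \<subseteq> X" "H' \<subseteq> H"
  shows "separated X' Y K H'"
proof -
  have "finite X \<and> finite H \<and> X \<inter> H = {}" using sep by (simp add: separated_def)
  then have 1: "finite X'" "finite H'" "X' \<inter> H' = {}" using sub by (auto intro: finite_subset)
  have 2: "X' \<inter> K y = {} \<and> K y \<inter> H' = {} \<and> (\<forall>u\<in>K y. \<forall>v\<in>H'. c u v = 0)" if "y \<in> Y" for y
  proof -
    have "X \<inter> K y = {} \<and> K y \<inter> H = {} \<and> (\<forall>u\<in>K y. \<forall>v\<in>H. c u v = 0)"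
      using sep that by (simp add: separated_def)
    then show ?thesis using sub by blast
  qed
  show ?thesis using sep 1 2 by (simp add: separated_def)
qed

lemma separated_disjoint:
  assumes sep: "separated X Y K H"
  shows "X \<inter> H = {}" "X \<inter> (\<Union>y\<in>Y. K y) = {}" "(\<Union>y\<in>Y. K y) \<inter> H = {}"
    "y \<in> Y \<Longrightarrow> K y \<inter> (\<Union>z\<in>Y - {y}. K z) = {}"
proof -
  have "X \<inter> K y = {}" "K y \<inter> H = {}" if "y \<in> Y" for y
    using sep that by (simp_all add: separated_def)
  then show "X \<inter> (\<Union>y\<in>Y. K y) = {}" "(\<Union>y\<in>Y. K y) \<inter> H = {}" by blast+
  show "X \<inter> H = {}" using sep by (simp add: separated_def)
  have "K y \<inter> K z = {}" if "y \<in> Y" "z \<in> Y" "y \<noteq> z" for z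
    using sep that by (simp add: separated_def)
  then show "K y \<inter> (\<Union>z\<in>Y - {y}. K z) = {}" if "y \<in> Y" using that by blast
qed

text \<open>Used after deleting a vertex of \<open>K y\<close>: the remainder need not be critical
  and is moved into \<open>H\<close>.\<close>

lemma separated_absorb:
  assumes sep: "separated X Y K H" and y: "y \<in> Y" and L: "L \<subseteq> K y"
  shows "separated X (Y - {y}) K (H \<union> L)"
proof -
  have "X \<inter> K y = {}" "finite L"
    using sep y finite_subset[OF L] by (simp_all add: separated_def)
  then have L': "finite L" "X \<inter> L = {}" using L by blast+
  have Lz: "K z \<inter> L = {} \<and> (\<forall>u\<in>K z. \<forall>v\<in>L. c u v = 0)" if "z \<in> Y - {y}" for z
  proof -
    have "K z \<inter> K y = {}" "\<forall>u\<in>K z. \<forall>v\<in>K y. c u v = 0"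
      using sep y that by (auto simp: separated_def)
    then show ?thesis using L by blast
  qed
  have Kz: "finite (K z) \<and> X \<inter> K z = {} \<and> K z \<inter> (H \<union> L) = {} \<and> (\<forall>u\<in>K z. \<forall>v\<in>H \<union> L. c u v = 0) \<and>
      (\<forall>t\<in>Y - {y}. z \<noteq> t \<longrightarrow> K z \<inter> K t = {} \<and> (\<forall>u\<in>K z. \<forall>v\<in>K t. c u v = 0))"
    if "z \<in> Y - {y}" for z
    using sep that Lz[OF that] by (simp add: separated_def Int_Un_distrib ball_Un) blast
  have "finite X \<and> finite (Y - {y}) \<and> finite (H \<union> L) \<and> X \<inter> (H \<union> L) = {}"
    using sep L' by (simp add: separated_def Int_Un_distrib)
  then show ?thesis using Kz by (simp only: separated_def) blast
qed

lemma mul_separated: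
  assumes "separated {} Y K H"
  shows "mul ((\<Union>y\<in>Y. K y) \<union> H) = mul H + (\<Sum>y\<in>Y. mul (K y))"
proof -
  have "finite Y" using assms by (simp add: separated_def)
  then show ?thesis using assms
  proof (induction Y rule: finite_induct)
    case (insert y Y)
    then have "separated {} Y K H" by (simp add: separated_def)
    moreover have "mul (K y \<union> ((\<Union>y\<in>Y. K y) \<union> H)) = mul (K y) + mul ((\<Union>y\<in>Y. K y) \<union> H)"
    proof (rule mul_disjoint_union)
      have "y \<noteq> z" if "z \<in> Y" for z using that insert.hyps by blast
      then have K: "K y \<inter> K z = {} \<and> (\<forall>u\<in>K y. \<forall>v\<in>K z. c u v = 0)" if "z \<in> Y" for z
        using insert.prems that unfolding separated_def by simp
      have H: "K y \<inter> H = {} \<and> (\<forall>u\<in>K y. \<forall>v\<in>H. c u v = 0)"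
        using insert.prems unfolding separated_def by simp
      show "K y \<inter> ((\<Union>y\<in>Y. K y) \<union> H) = {}" using K H by blast
      show "c u v = 0" if "u \<in> K y" "v \<in> (\<Union>y\<in>Y. K y) \<union> H" for u v using K H that by blast
    qed (use insert.prems insert.hyps in \<open>simp_all add: separated_def\<close>)
    ultimately show ?case using insert by (simp add: Un_assoc)
  qed simp
qed

text \<open>Induction on \<open>X\<close>, with \<open>Y\<close> and \<open>H\<close> varying: the
  induction hypothesis is used once for the graph without \<open>x\<close>, and once without
  \<open>x\<close> and its neighbour \<open>u\<close> in the matched part, whose remainder joins
  \<open>H\<close>. The additive form avoids truncated subtraction.\<close>

lemma mul_matched:
  assumes "separated X Y K H" "inj_on \<phi> X" "\<phi> ` X \<subseteq> Y"
    and "\<And>x. x \<in> X \<Longrightarrow> \<exists>u\<in>K (\<phi> x). 0 < c x u"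
    and "\<And>y u. y \<in> Y \<Longrightarrow> u \<in> K y \<Longrightarrow> Suc (mul (K y - {u})) = mul (K y)"
  shows "mul (X \<union> (\<Union>y\<in>Y. K y) \<union> H) + card X = mul H + (\<Sum>y\<in>Y. mul (K y))"
proof -
  have "finite X" using assms(1) by (simp add: separated_def)
  then show ?thesis using assms
  proof (induction X arbitrary: Y H rule: finite_induct)
    case (insert x X)
    note sep = insert.prems(1) and crit = insert.prems(5)
    let ?K = "\<Union>y\<in>Y. K y"
    define y where "y = \<phi> x"
    have y: "y \<in> Y" using insert.prems(3) by (simp add: y_def)
    obtain u where u: "u \<in> K y" "0 < c x u" using insert.prems(4) unfolding y_def by blast
    have fin: "finite Y" "finite H" "finite (K y)" using sep y by (auto simp: separated_def)
    define S where "S = insert x X \<union> ?K \<union> H"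
    have "finite S" using sep by (auto simp: S_def separated_def)
    have sep': "separated X Y K H" by (rule separated_mono[OF sep]) auto
    have S1: "S - {x} = X \<union> ?K \<union> H"
    proof -
      have "x \<notin> ?K \<union> H" using separated_disjoint(1,2)[OF sep] by blast
      then show ?thesis using insert.hyps by (auto simp: S_def)
    qed
    have S2: "S - {x} - {u} = X \<union> (\<Union>y\<in>Y - {y}. K y) \<union> (H \<union> (K y - {u}))"
    proof -
      have "u \<notin> X" "u \<notin> H" "u \<notin> (\<Union>y\<in>Y - {y}. K y)"
        using separated_disjoint(2,3)[OF sep] separated_disjoint(4)[OF sep y] u y by blast+
      moreover have "?K = (\<Union>y\<in>Y - {y}. K y) \<union> K y" using y by blast
      ultimately show ?thesis unfolding S1 by blast
    qed
    have 1: "mul (S - {x}) + card X = mul H + (\<Sum>y\<in>Y. mul (K y))"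
      unfolding S1 using insert.prems by (intro insert.IH[OF sep']) auto
    have "mul (S - {x} - {u}) + card X = mul (H \<union> (K y - {u})) + (\<Sum>y\<in>Y - {y}. mul (K y))"
      unfolding S2
    proof (rule insert.IH)
      show "separated X (Y - {y}) K (H \<union> (K y - {u}))"
        by (rule separated_absorb[OF sep' y]) auto
      show "\<phi> ` X \<subseteq> Y - {y}"
        using insert.prems(2,3) insert.hyps by (auto simp: y_def) (metis image_eqI)
    qed (use insert.prems in auto)
    moreover have "mul (H \<union> (K y - {u})) = mul (K y - {u}) + mul H"
    proof -
      have "K y \<inter> H = {}" "\<forall>u\<in>K y. \<forall>v\<in>H. c u v = 0"
        using sep y by (simp_all add: separated_def)
      then have "mul ((K y - {u}) \<union> H) = mul (K y - {u}) + mul H"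
        using fin by (intro mul_disjoint_union) auto
      then show ?thesis by (simp only: Un_commute)
    qed
    moreover have "(\<Sum>y\<in>Y. mul (K y)) = mul (K y) + (\<Sum>y\<in>Y - {y}. mul (K y))"
      using fin y by (simp add: sum.remove)
    \<comment> \<open>The two formulas differ only in \<open>mul (K y - {u})\<close> against
      \<open>mul (K y)\<close>, so criticality of \<open>K y\<close> makes \<open>u\<close>
      essential in \<open>S - {x}\<close>.\<close>
    ultimately have "Suc (mul (S - {x} - {u})) = mul (S - {x})"
      using 1 crit[OF y u(1)] by simp
    moreover have "u \<in> S - {x}" unfolding S1 using y u by blast
    ultimately have "Suc (mul S) = mul (S - {x})"
      using u(2) \<open>finite S\<close> by (intro mul_remove_adjacent_essential) (auto simp: S_def)
    then show ?case using 1 insert.hyps unfolding S_def by simp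
  qed (simp add: mul_separated)
qed

text \<open>Compare the formula of \<open>mul_matched\<close> before and after deleting
  \<open>v\<close>. In \<open>X\<close> one matched vertex fewer raises the multiplicity; in
  \<open>K y\<close> criticality lowers it by one; in \<open>H\<close> it cannot drop, as
  \<open>mul H\<close> is already zero.\<close>

lemma essential_iff:
  assumes sep: "separated X Y K H" and "mul H = 0"
    and crit: "\<And>y u. y \<in> Y \<Longrightarrow> u \<in> K y \<Longrightarrow> Suc (mul (K y - {u})) = mul (K y)"
    and match: "\<And>y. \<exists>\<phi>. inj_on \<phi> X \<and> \<phi> ` X \<subseteq> Y - {y} \<and> (\<forall>x\<in>X. \<exists>u\<in>K (\<phi> x). 0 < c x u)"
    and V: "V = X \<union> (\<Union>y\<in>Y. K y) \<union> H" and "v \<in> V"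
  shows "Suc (mul (V - {v})) = mul V \<longleftrightarrow> v \<in> (\<Union>y\<in>Y. K y)"
proof -
  have fin: "finite X" "finite Y" "finite H" using sep by (simp_all add: separated_def)
  \<comment> \<open>Any matching into \<open>Y\<close> will do here; \<open>undefined\<close> only
    fills the place of the avoided element.\<close>
  from match[of undefined] obtain \<phi> where
    "inj_on \<phi> X \<and> \<phi> ` X \<subseteq> Y - {undefined} \<and> (\<forall>x\<in>X. \<exists>u\<in>K (\<phi> x). 0 < c x u)" by (rule exE)
  then have \<phi>: "inj_on \<phi> X" "\<phi> ` X \<subseteq> Y" "\<And>x. x \<in> X \<Longrightarrow> \<exists>u\<in>K (\<phi> x). 0 < c x u"
    by (simp_all add: subset_Diff_insert)
  have total: "mul V + card X = (\<Sum>y\<in>Y. mul (K y))"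
    using mul_matched[OF sep \<phi> crit] \<open>mul H = 0\<close> V by simp
  from \<open>v \<in> V\<close> consider "v \<in> X" | y where "y \<in> Y" "v \<in> K y" | "v \<in> H" unfolding V by blast
  then show ?thesis
  proof cases
    case 1
    have notin: "v \<notin> H" "v \<notin> (\<Union>y\<in>Y. K y)" using separated_disjoint(1,2)[OF sep] 1 by blast+
    have "separated (X - {v}) Y K H" by (rule separated_mono[OF sep]) auto
    then have "mul ((X - {v}) \<union> (\<Union>y\<in>Y. K y) \<union> H) + card (X - {v}) = mul H + (\<Sum>y\<in>Y. mul (K y))"
    proof (rule mul_matched)
      show "inj_on \<phi> (X - {v})" using \<phi>(1) by (rule inj_on_subset) blast
      show "\<phi> ` (X - {v}) \<subseteq> Y" using \<phi>(2) by blast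
    qed (use \<phi>(3) crit in auto)
    moreover have "(X - {v}) \<union> (\<Union>y\<in>Y. K y) \<union> H = V - {v}" using notin unfolding V by blast
    moreover have "card X = Suc (card (X - {v}))" using 1 fin by (metis card_Suc_Diff1)
    ultimately show ?thesis using total notin \<open>mul H = 0\<close> by simp
  next
    case (2 y)
    \<comment> \<open>The matching must avoid \<open>y\<close>, because the remainder of
      \<open>K y\<close> is absorbed into \<open>H\<close> and leaves the family of critical
      parts.\<close>
    from match[of y] obtain \<psi> where
      "inj_on \<psi> X \<and> \<psi> ` X \<subseteq> Y - {y} \<and> (\<forall>x\<in>X. \<exists>u\<in>K (\<psi> x). 0 < c x u)" by (rule exE)
    then have \<psi>: "inj_on \<psi> X" "\<psi> ` X \<subseteq> Y - {y}" "\<And>x. x \<in> X \<Longrightarrow> \<exists>u\<in>K (\<psi> x). 0 < c x u"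
      by simp_all
    have "mul (X \<union> (\<Union>y\<in>Y - {y}. K y) \<union> (H \<union> (K y - {v}))) + card X
        = mul (H \<union> (K y - {v})) + (\<Sum>y\<in>Y - {y}. mul (K y))"
      using separated_absorb[OF sep 2(1), of "K y - {v}"] \<psi> crit by (intro mul_matched[of X _ K _ \<psi>]) simp_all
    moreover have "X \<union> (\<Union>y\<in>Y - {y}. K y) \<union> (H \<union> (K y - {v})) = V - {v}"
    proof -
      have "v \<notin> X" "v \<notin> H" "v \<notin> (\<Union>y\<in>Y - {y}. K y)"
        using separated_disjoint(2,3)[OF sep] separated_disjoint(4)[OF sep 2(1)] 2 by blast+
      moreover have "(\<Union>y\<in>Y. K y) = (\<Union>y\<in>Y - {y}. K y) \<union> K y" using 2 by blast
      ultimately show ?thesis unfolding V by blast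
    qed
    moreover have "mul (H \<union> (K y - {v})) = mul (K y - {v})"
    proof -
      have "finite (K y)" "K y \<inter> H = {}" "\<forall>u\<in>K y. \<forall>v\<in>H. c u v = 0"
        using sep 2(1) by (simp_all add: separated_def)
      then have "mul ((K y - {v}) \<union> H) = mul (K y - {v}) + mul H"
        using fin by (intro mul_disjoint_union) auto
      then show ?thesis using \<open>mul H = 0\<close> by (simp add: Un_commute)
    qed
    moreover have "(\<Sum>y\<in>Y. mul (K y)) = mul (K y) + (\<Sum>y\<in>Y - {y}. mul (K y))"
      using fin 2(1) by (simp add: sum.remove)
    ultimately show ?thesis using total crit[OF 2] 2 by auto
  next
    case 3
    have notin: "v \<notin> X" "v \<notin> (\<Union>y\<in>Y. K y)" using separated_disjoint(1,3)[OF sep] 3 by blast+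
    have "separated X Y K (H - {v})" by (rule separated_mono[OF sep]) auto
    then have "mul (X \<union> (\<Union>y\<in>Y. K y) \<union> (H - {v})) + card X = mul (H - {v}) + (\<Sum>y\<in>Y. mul (K y))"
      using \<phi> crit by (rule mul_matched)
    moreover have "X \<union> (\<Union>y\<in>Y. K y) \<union> (H - {v}) = V - {v}" using notin unfolding V by blast
    ultimately show ?thesis using total notin by simp
  qed
qed

end

section \<open>Matching polynomials\<close>

text \<open>Factor out the zero of \<open>p\<close> over the reals. The complexified product agrees
  with \<open>P\<close> at infinitely many points, hence equals it. This reduces multiplicities to
  real polynomials, where the Wronskian inequalities make sense.\<close>

lemma order_of_real_poly:
  fixes p :: "real poly" and P :: "complex poly"
  assumes "p \<noteq> 0" and eval: "\<And>x. poly P (complex_of_real x) = complex_of_real (poly p x)"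
  shows "order (complex_of_real a) P = order a p"
proof -
  obtain q where q: "p = [:- a, 1:] ^ order a p * q" "poly q a \<noteq> 0"
    using order_decomp_root[OF assms(1)] .
  define Q where "Q = map_poly complex_of_real q"
  have Q: "poly Q (complex_of_real x) = complex_of_real (poly q x)" for x
    unfolding Q_def by (induction q) (simp_all add: map_poly_pCons)
  define R where "R = [:- complex_of_real a, 1:] ^ order a p * Q"
  have "poly (P - R) (complex_of_real x) = 0" for x
    using arg_cong[OF q(1), of "\<lambda>p. complex_of_real (poly p x)"] by (simp add: R_def eval Q)
  then have "range complex_of_real \<subseteq> {z. poly (P - R) z = 0}" by auto
  moreover have "infinite (range complex_of_real)"
    by (simp add: finite_image_iff inj_of_real infinite_UNIV_char_0)
  ultimately have "infinite {z. poly (P - R) z = 0}" by (rule infinite_super)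
  then have "P = R" using poly_roots_finite[of "P - R"] by auto
  moreover have "poly Q (complex_of_real a) \<noteq> 0" using Q q(2) by simp
  moreover have "order (complex_of_real a) ([:- complex_of_real a, 1:] ^ order a p) = order a p"
    by (rule order_power_n_n)
  ultimately show ?thesis by (subst \<open>P = R\<close>, unfold R_def, subst order_mult) (auto simp: order_0I)
qed

lemma smult_sum_right: "smult c (\<Sum>i\<in>A. p i) = (\<Sum>i\<in>A. smult c (p i))"
  by (induction A rule: infinite_finite_induct) (simp_all add: smult_add_right)

lemma covered_subset_iff: "covered G M \<subseteq> S \<longleftrightarrow> (\<forall>e\<in>M. ends G e \<subseteq> S)"
  by (auto simp: covered_def)

lemma covered_insert: "covered G (insert e M) = ends G e \<union> covered G M"
  by (simp add: covered_def)

section \<open>Matchings of induced subgraphs and the vertex recursion of their polynomials\<close>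

context schroedinger_graph
begin

lemma finite_matchings: "finite (matchings G r)"
  by (rule finite_subset[of _ "Pow (edges G r)"]) (auto simp: matchings_def edges_def)

lemma edge_arcs:
  assumes "e \<in> edges G r" "a \<in> e"
  shows "a \<in> arcs G" "e = {a, r a}"
  using assms by (auto simp: edges_def)

lemma ends_arc: "a \<in> arcs G \<Longrightarrow> ends G {a, r a} = {tail G a, head G a}"
  by (simp add: ends_def)

lemma matching_finite: "M \<in> matchings G r \<Longrightarrow> finite M" "M \<in> matchings G r \<Longrightarrow> finite (\<Union>M)"
proof -
  assume M: "M \<in> matchings G r"
  then have "M \<subseteq> edges G r" by (simp add: matchings_def)
  moreover have "finite (edges G r)" by (simp add: edges_def)
  moreover have "finite e" if "e \<in> edges G r" for e using that by (auto simp: edges_def)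
  ultimately show "finite M" "finite (\<Union>M)" by (auto intro: finite_subset)
qed

lemma matchings_induce_subgraph:
  "matchings (G \<restriction> S) r = {M \<in> matchings G r. covered G M \<subseteq> S}"
proof -
  have "e \<in> edges (G \<restriction> S) r \<longleftrightarrow> e \<in> edges G r \<and> ends G e \<subseteq> S" for e
    by (auto simp: edges_def ends_arc)
  then show ?thesis
    by (auto simp: matchings_def covered_subset_iff ends_def)
qed

text \<open>Taking moduli of the weights keeps the values on the reals, because the two orientations
  of an edge have conjugate weights. All sums run over matchings of the one graph \<open>G\<close>,
  with the vertex set as parameter.\<close>

definition real_matching_poly :: "('v \<Rightarrow> real) \<Rightarrow> 'v set \<Rightarrow> real poly" where
  "real_matching_poly U S = (\<Sum>M | M \<in> matchings G r \<and> covered G M \<subseteq> S.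
     smult ((-1) ^ card M * (\<Prod>a\<in>\<Union>M. cmod (w a))) (\<Prod>u\<in>S - covered G M. [:- U u, 1:]))"

lemma matching_weight_real:
  assumes M: "M \<in> matchings G r"
  shows "(\<Prod>a\<in>\<Union>M. w a) = complex_of_real (\<Prod>a\<in>\<Union>M. cmod (w a))"
proof -
  have e: "\<exists>a\<in>arcs G. e = {a, r a}" if "e \<in> M" for e
    using M that by (auto simp: matchings_def edges_def)
  \<comment> \<open>Edges are sets of arcs; two edges with a common arc would share its
    tail.\<close>
  have "e \<inter> f = {}" if "e \<in> M" "f \<in> M" "e \<noteq> f" for e f
  proof -
    have "tail G ` e \<inter> tail G ` f = {}"
      using M that by (auto simp: matchings_def pairwise_def disjnt_def ends_def)
    then show ?thesis by blast
  qed
  then have Union: "prod h (\<Union>M) = (\<Prod>e\<in>M. prod h e)" for h :: "'e \<Rightarrow> complex"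
    using e by (subst prod.Union_disjoint) auto
  have "prod w e = (\<Prod>a\<in>e. complex_of_real (cmod (w a)))" if "e \<in> M" for e
  proof -
    obtain a where a: "a \<in> arcs G" "e = {a, r a}" using e \<open>e \<in> M\<close> by blast
    have "w a * cnj (w a) = complex_of_real (cmod (w a)) * complex_of_real (cmod (w a))"
      by (simp add: power2_eq_square flip: complex_norm_square of_real_mult)
    then show ?thesis using a arev_neq[OF a(1)] weight_rev[OF a(1)] by simp
  qed
  then show ?thesis unfolding of_real_prod Union by (rule prod.cong[OF refl])
qed

lemma poly_matching_poly_induce_subgraph:
  "poly (matching_poly (G \<restriction> S) r w U) (complex_of_real x)
    = complex_of_real (poly (real_matching_poly U S) x)"
  unfolding matching_poly_def real_matching_poly_def matchings_induce_subgraph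
  by (simp add: poly_sum poly_prod covered_def ends_def matching_weight_real of_real_sum of_real_prod)

text \<open>Parallel edges add up. For distinct \<open>u\<close> and \<open>v\<close> each edge
  joining them enters once, by its orientation from \<open>u\<close> to \<open>v\<close>, with the
  product of the weights of both orientations.\<close>

definition coupling :: "'v \<Rightarrow> 'v \<Rightarrow> real" where
  "coupling u v = (\<Sum>a | a \<in> arcs G \<and> tail G a = u \<and> head G a = v. (cmod (w a))\<^sup>2)"

lemma coupling_nonneg: "0 \<le> coupling u v"
  by (simp add: coupling_def sum_nonneg)

lemma coupling_pos: "a \<in> arcs G \<Longrightarrow> 0 < coupling (tail G a) (head G a)"
  unfolding coupling_def by (rule sum_pos2[where i = a]) (auto simp: weight_nonzero)

lemma coupling_eq_0: "(\<And>a. a \<in> arcs G \<Longrightarrow> tail G a = u \<Longrightarrow> head G a \<noteq> v) \<Longrightarrow> coupling u v = 0"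
  unfolding coupling_def by (intro sum.neutral) auto

lemma insert_edge_matching:
  assumes "a \<in> arcs G" "tail G a \<noteq> head G a" "M \<in> matchings G r"
    and "tail G a \<notin> covered G M" "head G a \<notin> covered G M"
  shows "insert {a, r a} M \<in> matchings G r"
proof -
  have "disjnt (ends G {a, r a}) (ends G f)" if "f \<in> M" for f
    using assms(4,5) that unfolding ends_arc[OF assms(1)] by (auto simp: covered_def disjnt_def)
  then show ?thesis
    using assms(1-3) by (auto simp: matchings_def edges_def pairwise_insert disjnt_sym)
qed

text \<open>A matching covering \<open>v\<close> consists of its unique edge at \<open>v\<close> and
  a matching avoiding both ends of that edge. Indexing by arcs with tail \<open>v\<close> records
  the other end as the head.\<close>

lemma bij_betw_insert_edge:
  assumes "v \<in> S"
  shows "bij_betw (\<lambda>(a, M). insert {a, r a} M)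
    (SIGMA a : {a \<in> arcs G. tail G a = v \<and> head G a \<in> S - {v}}.
      {M \<in> matchings G r. covered G M \<subseteq> S - {v} - {head G a}})
    {M \<in> matchings G r. covered G M \<subseteq> S \<and> v \<in> covered G M}"
    (is "bij_betw ?h ?D ?R")
  unfolding bij_betw_def
proof
  \<comment> \<open>These facts recover \<open>a\<close> and \<open>M\<close> from the enlarged
    matching: the edge is the only one at \<open>v\<close>, and \<open>a\<close> is its only
    orientation starting there.\<close>
  have edge: "{f \<in> insert {a, r a} M. v \<in> ends G f} = {{a, r a}}"
      "{a, r a} \<notin> M" "{b \<in> {a, r a}. tail G b = v} = {a}"
    if "(a, M) \<in> ?D" for a M
  proof -
    have a: "a \<in> arcs G" "tail G a = v" "head G a \<noteq> v" and "v \<notin> covered G M"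
      using that by auto
    moreover from this have "v \<notin> ends G f" if "f \<in> M" for f using that by (auto simp: covered_def)
    moreover have "v \<in> ends G {a, r a}" using a by (simp add: ends_arc)
    ultimately show "{f \<in> insert {a, r a} M. v \<in> ends G f} = {{a, r a}}" "{a, r a} \<notin> M"
      by auto
    show "{b \<in> {a, r a}. tail G b = v} = {a}" using a by auto
  qed
  show "inj_on ?h ?D"
  proof (rule inj_onI)
    fix p q
    assume pq: "p \<in> ?D" "q \<in> ?D" "?h p = ?h q"
    obtain a M b N where p: "p = (a, M)" and q: "q = (b, N)" by (cases p, cases q)
    have D: "(a, M) \<in> ?D" "(b, N) \<in> ?D" and eq: "insert {a, r a} M = insert {b, r b} N"
      using pq unfolding p q by auto
    have e: "{a, r a} = {b, r b}" using edge(1)[OF D(1)] edge(1)[OF D(2)] eq by simp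
    then have "{a} = {b}" using edge(3)[OF D(1)] edge(3)[OF D(2)] by simp
    moreover have "M = N" using edge(2)[OF D(1)] edge(2)[OF D(2)] eq e by (metis insert_ident)
    ultimately show "p = q" unfolding p q by simp
  qed
  show "?h ` ?D = ?R"
  proof (intro equalityI subsetI)
    fix N assume "N \<in> ?h ` ?D"
    then obtain a M where aM: "(a, M) \<in> ?D" "N = insert {a, r a} M" by auto
    then have "insert {a, r a} M \<in> matchings G r" by (intro insert_edge_matching) auto
    then show "N \<in> ?R"
      using aM \<open>v \<in> S\<close> by (auto simp: covered_insert ends_arc)
  next
    fix N assume N: "N \<in> ?R"
    then obtain e where e: "e \<in> N" "v \<in> ends G e" by (auto simp: covered_def)
    then obtain a where a: "a \<in> e" "tail G a = v" by (auto simp: ends_def)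
    have "e \<in> edges G r" using N e by (auto simp: matchings_def)
    note arc = edge_arcs[OF this a(1)]
    have ends: "ends G e = {v, head G a}" using arc a(2) by (simp add: ends_arc)
    have "tail G a \<noteq> head G a" using N e(1) a(1) unfolding matchings_def by blast
    then have "head G a \<noteq> v" using a(2) by simp
    moreover have "head G a \<in> S" using N e ends unfolding mem_Collect_eq covered_subset_iff by auto
    moreover have "N - {e} \<in> matchings G r"
      using N by (auto simp: matchings_def intro: pairwise_subset)
    moreover have "covered G (N - {e}) \<subseteq> S - {v} - {head G a}"
    proof -
      have "disjnt (ends G e) (ends G f)" if "f \<in> N - {e}" for f
        using N e that by (auto simp: matchings_def pairwise_def)
      then show ?thesis using N unfolding mem_Collect_eq covered_subset_iff ends
        by (fastforce simp: disjnt_def)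
    qed
    ultimately have "(a, N - {e}) \<in> ?D" using arc a by auto
    moreover have "N = ?h (a, N - {e})" using e(1) arc(2) by auto
    ultimately show "N \<in> ?h ` ?D" by (rule rev_image_eqI)
  qed
qed

text \<open>Split the matchings by whether they cover \<open>v\<close>. If not, \<open>v\<close>
  contributes a linear factor; if so, removing the edge at \<open>v\<close> costs a sign and a
  squared weight, and grouping the arcs by their heads yields the couplings.\<close>

lemma real_matching_poly_rec:
  assumes "finite S" "v \<in> S"
  shows "real_matching_poly U S = [:- U v, 1:] * real_matching_poly U (S - {v})
    - (\<Sum>u\<in>S - {v}. smult (coupling v u) (real_matching_poly U (S - {v} - {u})))"
proof -
  define T where "T S M = smult ((-1) ^ card M * (\<Prod>a\<in>\<Union>M. cmod (w a))) (\<Prod>u\<in>S - covered G M. [:- U u, 1:])"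
    for S M
  define MM where "MM S = {M \<in> matchings G r. covered G M \<subseteq> S}" for S
  have poly: "real_matching_poly U S = sum (T S) (MM S)" for S
    by (simp add: real_matching_poly_def T_def MM_def)
  have fin: "finite (MM S)" for S using finite_matchings by (simp add: MM_def)
  let ?A = "{a \<in> arcs G. tail G a = v \<and> head G a \<in> S - {v}}"
  let ?N = "{M \<in> matchings G r. covered G M \<subseteq> S \<and> v \<in> covered G M}"
  have "MM S = MM (S - {v}) \<union> ?N" "MM (S - {v}) \<inter> ?N = {}" by (auto simp: MM_def)
  then have "real_matching_poly U S = sum (T S) (MM (S - {v})) + sum (T S) ?N"
    unfolding poly using fin finite_matchings by (simp add: sum.union_disjoint)
  also have "sum (T S) (MM (S - {v})) = [:- U v, 1:] * real_matching_poly U (S - {v})"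
  proof -
    have "T S M = [:- U v, 1:] * T (S - {v}) M" if "M \<in> MM (S - {v})" for M
    proof -
      have "S - covered G M = insert v (S - {v} - covered G M)" using that assms(2) by (auto simp: MM_def)
      then have "(\<Prod>u\<in>S - covered G M. [:- U u, 1:])
          = [:- U v, 1:] * (\<Prod>u\<in>S - {v} - covered G M. [:- U u, 1:])"
        using assms(1) by simp
      then show ?thesis unfolding T_def by (simp only: mult_smult_right)
    qed
    then show ?thesis unfolding poly by (simp only: sum_distrib_left cong: sum.cong)
  qed
  also have "sum (T S) ?N = (\<Sum>a\<in>?A. - smult ((cmod (w a))\<^sup>2) (real_matching_poly U (S - {v} - {head G a})))"
  proof -
    have "T S (insert {a, r a} M) = - smult ((cmod (w a))\<^sup>2) (T (S - {v} - {head G a}) M)"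
      if "a \<in> ?A" "M \<in> MM (S - {v} - {head G a})" for a M
    proof -
      have a: "a \<in> arcs G" "tail G a = v" and M: "M \<in> matchings G r" "v \<notin> covered G M"
          "head G a \<notin> covered G M"
        using that by (auto simp: MM_def)
      have "tail G b \<notin> covered G M" if "b \<in> {a, r a}" for b
        using that a M(2,3) by auto
      then have "b \<notin> \<Union>M" if "b \<in> {a, r a}" for b
        using that by (auto simp: covered_def ends_def)
      then have disj: "{a, r a} \<inter> \<Union>M = {}" "{a, r a} \<notin> M" by blast+
      have "(\<Prod>a\<in>\<Union>(insert {a, r a} M). cmod (w a)) = (cmod (w a))\<^sup>2 * (\<Prod>a\<in>\<Union>M. cmod (w a))"
        using disj matching_finite[OF M(1)] arev_neq[OF a(1)] weight_rev[OF a(1)]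
        by (simp add: power2_eq_square)
      moreover have "S - covered G (insert {a, r a} M) = S - {v} - {head G a} - covered G M"
        using a by (auto simp: covered_insert ends_arc)
      ultimately show ?thesis
        using disj(2) matching_finite(1)[OF M(1)] by (simp add: T_def mult_ac)
    qed
    then have "(\<Sum>a\<in>?A. \<Sum>M\<in>MM (S - {v} - {head G a}). T S (insert {a, r a} M))
        = (\<Sum>a\<in>?A. - smult ((cmod (w a))\<^sup>2) (real_matching_poly U (S - {v} - {head G a})))"
      unfolding poly smult_sum_right sum_negf[symmetric] by (intro sum.cong refl) auto
    moreover have "sum (T S) ?N = (\<Sum>a\<in>?A. \<Sum>M\<in>MM (S - {v} - {head G a}). T S (insert {a, r a} M))"
      unfolding sum.reindex_bij_betw[OF bij_betw_insert_edge[OF assms(2)], symmetric]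
      by (subst sum.Sigma) (use fin in \<open>auto simp: MM_def intro!: sum.cong\<close>)
    ultimately show ?thesis by simp
  qed
  also have "\<dots> = - (\<Sum>u\<in>S - {v}. smult (coupling v u) (real_matching_poly U (S - {v} - {u})))"
  proof -
    let ?f = "\<lambda>a. smult ((cmod (w a))\<^sup>2) (real_matching_poly U (S - {v} - {head G a}))"
    have "sum ?f ?A = (\<Sum>u\<in>S - {v}. sum ?f {a \<in> ?A. head G a = u})"
      using assms(1) by (intro sum.group[symmetric]) auto
    also have "\<dots> = (\<Sum>u\<in>S - {v}. smult (coupling v u) (real_matching_poly U (S - {v} - {u})))"
      unfolding coupling_def smult_sum by (intro sum.cong refl) auto
    finally show ?thesis by (simp add: sum_negf)
  qed
  finally show ?thesis by simp
qed

lemma real_matching_poly_empty: "real_matching_poly U {} = 1"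
proof -
  have "M = {}" if "M \<in> matchings G r" "covered G M = {}" for M
    using that by (auto simp: matchings_def covered_def edges_def ends_def)
  moreover have "{} \<in> matchings G r" by (simp add: matchings_def)
  ultimately have "{M. M \<in> matchings G r \<and> covered G M \<subseteq> {}} = {{}}" by (auto simp: covered_def)
  then show ?thesis by (simp add: real_matching_poly_def covered_def)
qed

lemma vertex_recursion_real_matching_poly: "vertex_recursion coupling U (real_matching_poly U)"
  by unfold_locales (auto simp: coupling_nonneg real_matching_poly_empty real_matching_poly_rec
      simp del: mult_pCons_left)

lemma mult_induce_subgraph:
  assumes "finite S"
  shows "mult \<theta> (G \<restriction> S) r w U = order \<theta> (real_matching_poly U S)"
proof -
  interpret vertex_recursion coupling U "real_matching_poly U" \<theta>
    by (rule vertex_recursion_real_matching_poly)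
  show ?thesis unfolding mult_def
    using mp_nonzero[OF assms] poly_matching_poly_induce_subgraph by (rule order_of_real_poly)
qed

end

section \<open>Components\<close>

lemma del_vert_induce_subgraph: "pre_digraph.del_vert (G \<restriction> S) v = G \<restriction> (S - {v})"
  by (auto simp: pre_digraph.del_vert_def induce_subgraph_def)

lemma induce_subgraph_restrict: "T \<subseteq> S \<Longrightarrow> (G \<restriction> S) \<restriction> T = G \<restriction> T"
  by (auto simp: induce_subgraph_def)

text \<open>No path leaves a part and any two vertices of a part reach each other, so the parts are
  the maximal sets of mutually reachable vertices.\<close>

lemma sccs_disjoint_parts:
  assumes "wf_digraph G" and V: "verts G = (\<Union>i\<in>I. W i)"
    and disjoint: "\<And>i j. i \<in> I \<Longrightarrow> j \<in> I \<Longrightarrow> i \<noteq> j \<Longrightarrow> W i \<inter> W j = {}"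
    and conn: "\<And>i. i \<in> I \<Longrightarrow> strongly_connected (G \<restriction> W i)"
    and closed: "\<And>i u v. i \<in> I \<Longrightarrow> u \<in> W i \<Longrightarrow> u \<rightarrow>\<^bsub>G\<^esub> v \<Longrightarrow> v \<in> W i"
  shows "pre_digraph.sccs G = (\<lambda>i. G \<restriction> W i) ` I"
proof -
  interpret wf_digraph G by fact
  have reach_closed: "v \<in> W i" if "u \<rightarrow>\<^sup>*\<^bsub>G\<^esub> v" "i \<in> I" "u \<in> W i" for i u v
    using that(1) by (induction rule: reachable_induct) (use that closed in auto)
  have reach: "u \<rightarrow>\<^sup>*\<^bsub>G\<^esub> v" if "i \<in> I" "u \<in> W i" "v \<in> W i" for i u v
  proof (rule reachable_mono)
    show "u \<rightarrow>\<^sup>*\<^bsub>G \<restriction> W i\<^esub> v" using conn[OF that(1)] that by (auto simp: strongly_connected_def)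
    show "subgraph (G \<restriction> W i) G" using that V by (intro induced_imp_subgraph induced_induce) auto
  qed
  have "sccs_verts = W ` I"
  proof (intro equalityI subsetI)
    fix S assume S: "S \<in> sccs_verts"
    then obtain u where u: "u \<in> S" by (auto simp: sccs_verts_def)
    then have "u \<rightarrow>\<^sup>*\<^bsub>G\<^esub> u" using S by (auto simp: sccs_verts_def)
    then have "u \<in> verts G" by (rule reachable_in_vertsE)
    then obtain i where i: "i \<in> I" "u \<in> W i" using V by auto
    have "S \<subseteq> W i" using S u i reach_closed unfolding sccs_verts_def by blast
    moreover have "v \<in> S" if "v \<in> W i" for v
      using S u reach[OF i that] reach[OF i(1) that i(2)] unfolding sccs_verts_def by blast
    ultimately show "S \<in> W ` I" using i by blast
  next
    fix S assume "S \<in> W ` I"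
    then obtain i where i: "i \<in> I" "S = W i" by blast
    moreover have "W i \<noteq> {}" using conn[OF i(1)] by (auto simp: strongly_connected_def)
    ultimately show "S \<in> sccs_verts"
      using reach reach_closed unfolding sccs_verts_def by blast
  qed
  then show ?thesis unfolding sccs_conv_sccs_verts by (simp add: image_image)
qed

section \<open>Critical components of the expansion\<close>

theorem theoremA1:
  fixes \<theta> :: real
    and B :: "('v + 'y, 'f) pre_digraph" and s :: "'f \<Rightarrow> 'f" and X :: "'v set" and Y :: "'y set"
    and G :: "('v, 'e) pre_digraph" and r :: "'e \<Rightarrow> 'e" and w :: "'e \<Rightarrow> complex" and U :: "'v \<Rightarrow> real"
    and K :: "'y \<Rightarrow> ('v, 'e) pre_digraph" and H :: "('v, 'e) pre_digraph"
  assumes "bipartite_graph B s X Y"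
    and "positive_surplus B (Inl ` X)"
    and "schroedinger_graph G r w"
    and "bipartite_expansion G B s X Y K H"
    and "\<And>y. y \<in> Y \<Longrightarrow> critical \<theta> (K y) r w U"
    and "poly (matching_poly H r w U) (complex_of_real \<theta>) \<noteq> 0"
  shows "critical_components \<theta> G r w U = K ` Y \<and>
    X = boundary G (essential_verts \<theta> G r w U)"
proof -
  interpret B: bipartite_graph B s X Y by fact
  interpret G: schroedinger_graph G r w by fact
  interpret E: bipartite_expansion G B s X Y K H by fact
  interpret R: vertex_recursion G.coupling U "G.real_matching_poly U" \<theta>
    by (rule G.vertex_recursion_real_matching_poly)
  let ?K = "\<lambda>y. verts (K y)" and ?H = "verts H" and ?V = "verts G"
  let ?D = "\<Union>y\<in>Y. verts (K y)"

  \<comment> \<open>Translation of the construction to vertex sets\<close>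
  have K_sub: "?K y \<subseteq> ?V" if "y \<in> Y" for y using E.verts_expansion that by auto
  have K_eq: "G \<restriction> ?K y = K y" if "y \<in> Y" for y
    by (rule G.induce_eq_iff_induced[OF E.induced_K[OF that]])
  have H_eq: "G \<restriction> ?H = H" by (rule G.induce_eq_iff_induced[OF E.induced_H])
  have G_eq: "G \<restriction> ?V = G" by (rule G.induce_eq_iff_induced[OF G.induced_subgraph_refl])
  have essential: "v \<in> essential_verts \<theta> (G \<restriction> S) r w U \<longleftrightarrow> v \<in> S \<and> Suc (R.mul (S - {v})) = R.mul S"
    if "finite S" for S v
    using that by (auto simp: essential_verts_def del_vert_induce_subgraph G.mult_induce_subgraph)

  have fin: "finite X" "finite Y"
    using B.finite_verts unfolding B.verts_bipartite by (auto dest: finite_PlusD)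
  have fin_K: "finite (?K y)" if "y \<in> Y" for y by (rule finite_subset[OF K_sub[OF that] G.finite_verts])
  have fin_H: "finite ?H" by (rule finite_subset[OF _ G.finite_verts]) (simp add: E.verts_expansion)

  have crit: "Suc (R.mul (?K y - {u})) = R.mul (?K y)" if "y \<in> Y" "u \<in> ?K y" for y u
    using assms(5)[OF that(1)] essential[OF fin_K[OF that(1)], of u] that
    by (simp add: critical_def K_eq)
  have H0: "R.mul ?H = 0"
    using assms(6) G.poly_matching_poly_induce_subgraph[of ?H U \<theta>]
    by (intro order_0I) (auto simp: H_eq)
  \<comment> \<open>Arcs starting in \<open>K y\<close> end in \<open>X\<close> or in
    \<open>K y\<close>, so the couplings to \<open>H\<close> and to the other parts are empty
    sums.\<close>
  have sep: "R.separated X Y ?K ?H"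
    unfolding R.separated_def
  proof (intro conjI ballI impI)
    fix y u v assume *: "y \<in> Y" "u \<in> ?K y"
    { assume "v \<in> ?H"
      then show "G.coupling u v = 0"
        using E.arcs_from_K[OF *(1)] E.disjoint_X_H E.disjoint_K_H[OF *(1)] *(2)
        by (intro G.coupling_eq_0) blast }
    { fix z assume "z \<in> Y" "y \<noteq> z" "v \<in> ?K z"
      then show "G.coupling u v = 0"
        using E.arcs_from_K[OF *(1)] E.disjoint_X_K[of z] E.disjoint_K_K[of y z] *
        by (intro G.coupling_eq_0) blast }
  qed (use fin fin_K fin_H E.disjoint_X_H E.disjoint_X_K E.disjoint_K_H E.disjoint_K_K in auto)

  \<comment> \<open>Matchings supplied by the positive surplus\<close>
  define N where "N x = {y \<in> Y. Inl x \<rightarrow>\<^bsub>B\<^esub> Inr y}" for x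
  have fin_N: "finite (N x)" for x using fin by (simp add: N_def)
  have surplus: "card S < card (\<Union>x\<in>S. N x)" if S: "S \<subseteq> X" "S \<noteq> {}" for S
  proof -
    have "boundary B (Inl ` S) \<subseteq> Inr ` (\<Union>x\<in>S. N x)"
    proof
      fix v assume "v \<in> boundary B (Inl ` S)"
      then obtain x where x: "x \<in> S" "Inl x \<rightarrow>\<^bsub>B\<^esub> v" by (auto simp: boundary_def)
      then obtain a where a: "a \<in> arcs B" "tail B a = Inl x" "head B a = v"
        by (auto simp: arcs_ends_conv)
      moreover have "Inl x \<in> Inl ` X" using x(1) S(1) by blast
      ultimately obtain y where "y \<in> Y" "v = Inr y" using B.arcs_bipartite[OF a(1)] by auto
      then show "v \<in> Inr ` (\<Union>x\<in>S. N x)" using x by (auto simp: N_def)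
    qed
    moreover have "finite (\<Union>x\<in>S. N x)" using fin_N finite_subset[OF S(1) fin(1)] by simp
    ultimately have "card (boundary B (Inl ` S)) \<le> card (\<Union>x\<in>S. N x)"
      by (meson card_image_le card_mono finite_imageI le_trans)
    moreover have "card S < card (boundary B (Inl ` S :: ('v + 'y) set))"
    proof -
      have "card S = card (Inl ` S :: ('v + 'y) set)" by (simp add: card_image)
      then show ?thesis using assms(2) S unfolding positive_surplus_def by (metis image_is_empty image_mono)
    qed
    ultimately show ?thesis by simp
  qed

  obtain \<phi> where \<phi>: "bij_betw \<phi> {a \<in> arcs B. tail B a \<in> Inl ` X}
        {a \<in> arcs G. tail G a \<in> X \<and> head G a \<in> ?D}"
      "\<And>a x y. a \<in> arcs B \<Longrightarrow> x \<in> X \<Longrightarrow> y \<in> Y \<Longrightarrow> tail B a = Inl x \<Longrightarrow> head B a = Inr y \<Longrightarrow>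
        tail G (\<phi> a) = x \<and> head G (\<phi> a) \<in> ?K y"
    using E.arcs_X_K by blast
  have arc: "\<exists>a\<in>arcs G. tail G a = x \<and> head G a \<in> ?K y" if xy: "x \<in> X" "y \<in> N x" for x y
  proof -
    obtain a where a: "a \<in> arcs B" "tail B a = Inl x" "head B a = Inr y" and y: "y \<in> Y"
      using xy(2) by (auto simp: N_def arcs_ends_conv)
    have "a \<in> {a \<in> arcs B. tail B a \<in> Inl ` X}" using a \<open>x \<in> X\<close> by simp
    then have "\<phi> a \<in> arcs G" using bij_betw_apply[OF \<phi>(1)] by blast
    then show ?thesis using \<phi>(2)[OF a(1) xy(1) y a(2,3)] by blast
  qed
  have coupled: "\<exists>u\<in>?K y. 0 < G.coupling x u" if "x \<in> X" "y \<in> N x" for x y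
    using arc[OF that] G.coupling_pos by blast

  have match: "\<exists>\<psi>. inj_on \<psi> X \<and> \<psi> ` X \<subseteq> Y - {y} \<and> (\<forall>x\<in>X. \<exists>u\<in>?K (\<psi> x). 0 < G.coupling x u)" for y
  proof -
    have "\<exists>\<psi>. inj_on \<psi> X \<and> (\<forall>x\<in>X. \<psi> x \<in> N x - {y})"
    proof (rule hall)
      fix S assume S: "S \<subseteq> X"
      have "(\<Union>x\<in>S. N x - {y}) = (\<Union>x\<in>S. N x) - {y}" by blast
      \<comment> \<open>A surplus of at least one outweighs the removal of the single element
        \<open>y\<close>.\<close>
      moreover have "card S \<le> card ((\<Union>x\<in>S. N x) - {y})"
        using surplus[OF S] by (cases "S = {}") (auto simp: card_Diff_singleton_if)
      ultimately show "card S \<le> card (\<Union>x\<in>S. N x - {y})" by simp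
    qed (use fin fin_N in auto)
    then obtain \<psi> where \<psi>: "inj_on \<psi> X" "\<And>x. x \<in> X \<Longrightarrow> \<psi> x \<in> N x - {y}" by blast
    moreover have "\<psi> ` X \<subseteq> Y - {y}" using \<psi>(2) by (auto simp: N_def)
    moreover have "\<forall>x\<in>X. \<exists>u\<in>?K (\<psi> x). 0 < G.coupling x u" using \<psi>(2) coupled by blast
    ultimately show ?thesis by blast
  qed

  \<comment> \<open>Essential vertices, their boundary and components\<close>
  have D: "essential_verts \<theta> G r w U = ?D"
  proof -
    have "v \<in> essential_verts \<theta> G r w U \<longleftrightarrow> v \<in> ?V \<and> v \<in> ?D" for v
      using essential[OF G.finite_verts, of v] R.essential_iff[OF sep H0 crit match E.verts_expansion, of v]
      unfolding G_eq by blast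
    then show ?thesis using K_sub by blast
  qed

  have "boundary G ?D = X"
  proof (intro equalityI subsetI)
    fix v assume "v \<in> boundary G ?D"
    then obtain a y where "y \<in> Y" "a \<in> arcs G" "tail G a \<in> ?K y" "head G a = v" "v \<notin> ?D"
      by (auto simp: boundary_def arcs_ends_conv)
    then show "v \<in> X" using E.arcs_from_K by blast
  next
    fix x assume x: "x \<in> X"
    \<comment> \<open>The surplus of the singleton gives \<open>x\<close> a neighbour; the boundary
      needs the reverse of the resulting arc, which symmetry provides.\<close>
    then have "N x \<noteq> {}" using surplus[of "{x}"] by auto
    then obtain y where y: "y \<in> N x" by blast
    then obtain a where a: "a \<in> arcs G" "tail G a = x" "head G a \<in> ?K y" using arc x by blast
    have "y \<in> Y" using y by (simp add: N_def)
    moreover have "head G a \<rightarrow>\<^bsub>G\<^esub> x" using G.graph_symmetric a G.in_arcs_imp_in_arcs_ends by metis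
    moreover have "x \<in> ?V - ?D" using x E.verts_expansion E.disjoint_X_K by blast
    ultimately show "x \<in> boundary G ?D" using a unfolding boundary_def by blast
  qed
  moreover have "pre_digraph.sccs (G \<restriction> ?D) = (\<lambda>y. (G \<restriction> ?D) \<restriction> ?K y) ` Y"
  proof (rule sccs_disjoint_parts)
    show "wf_digraph (G \<restriction> ?D)" by (auto simp: wf_digraph_def)
    fix y assume y: "y \<in> Y"
    have sub: "subgraph (K y) G" using E.induced_K[OF y] by (rule induced_imp_subgraph)
    have "symmetric (K y)" by (rule induced_graph_imp_symmetric[OF G.sym_arcs E.induced_K[OF y]])
    moreover have "Digraph_Component.connected (K y)" using assms(5)[OF y] by (simp add: critical_def)
    ultimately have "strongly_connected (K y)"
      using sub by (auto intro: wf_digraph.symmetric_connected_imp_strongly_connected)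
    moreover have "?K y \<subseteq> ?D" using y by blast
    ultimately show "strongly_connected ((G \<restriction> ?D) \<restriction> ?K y)"
      by (simp only: induce_subgraph_restrict K_eq[OF y])
    \<comment> \<open>Within \<open>?D\<close> the vertices of \<open>X\<close> are absent, so an
      arc starting in \<open>K y\<close> must stay in \<open>K y\<close>.\<close>
    fix u v assume "u \<in> ?K y" "u \<rightarrow>\<^bsub>G \<restriction> ?D\<^esub> v"
    then have "\<exists>a\<in>arcs G. tail G a \<in> ?K y \<and> head G a = v" "v \<in> ?D"
      by (auto simp: arcs_ends_conv)
    then show "v \<in> ?K y" using E.arcs_from_K[OF y] E.disjoint_X_K by blast
  qed (use E.disjoint_K_K in auto)
  moreover have "(\<lambda>y. (G \<restriction> ?D) \<restriction> ?K y) ` Y = K ` Y"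
  proof (rule image_cong[OF refl])
    fix y assume y: "y \<in> Y"
    then have "?K y \<subseteq> ?D" by blast
    then show "(G \<restriction> ?D) \<restriction> ?K y = K y" by (simp only: induce_subgraph_restrict K_eq[OF y])
  qed
  ultimately show ?thesis unfolding critical_components_def D by simp
qed

end
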